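(* Let $\beta$ be a non-empty permutation and let $\pi=2413\circledcirc\beta$. Then $$\mu[1,\pi]=\begin{cases}4 & \text{if } \beta=1,\\ -6 & \text{if } \beta=2413,\\ 2\,\mu[1,\beta] & \text{if } \beta \text{ is a 2413-balloon},\\ \mu[1,\beta] & \text{otherwise.}\end{cases}$$
   Context: Permutations are ordered by classical pattern containment ($\sigma\le\pi$ if $\pi$ has a subsequence order-isomorphic to $\sigma$), and $\mu[\sigma,\pi]$ is the Möbius function of this poset: $\mu[\sigma,\sigma]=1$, $\mu[\sigma,\pi]=0$ if $\sigma\not\le\pi$, and $\mu[\sigma,\pi]=-\sum_{\sigma\le\lambda<\pi}\mu[\sigma,\lambda]$ if $\sigma<\pi$. Here $1$ is the permutation of length one. For a non-empty permutation $\beta$ of length $b$, the 2413-balloon of $\beta$, written $2413\circledcirc\beta$, is the permutation of length $b+4$ given by $$2,\; b+4,\; \beta_1+2,\;\beta_2+2,\;\dots,\;\beta_b+2,\; 1,\; b+3.$$ A permutation is a 2413-balloon if it equals $2413\circledcirc\gamma$ for some non-empty permutation $\gamma$. *)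

theory Defs
  imports Main "HOL-Library.Sublist"
begin

text \<open>A permutation of length \<open>n\<close> is a list in one-line notation, with values \<open>1, \<dots>, n\<close>.\<close>

definition is_perm :: "nat list \<Rightarrow> bool" where
  "is_perm p \<longleftrightarrow> distinct p \<and> set p = {1..length p}"

definition order_isomorphic :: "nat list \<Rightarrow> nat list \<Rightarrow> bool" where
  "order_isomorphic xs ys \<longleftrightarrow> length xs = length ys \<and>
     (\<forall>i<length xs. \<forall>j<length xs. xs ! i < xs ! j \<longleftrightarrow> ys ! i < ys ! j)"

definition pattern_le :: "nat list \<Rightarrow> nat list \<Rightarrow> bool" (infix "\<preceq>" 50) where
  "\<sigma> \<preceq> \<pi> \<longleftrightarrow> (\<exists>xs. subseq xs \<pi> \<and> order_isomorphic xs \<sigma>)"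

definition pattern_less :: "nat list \<Rightarrow> nat list \<Rightarrow> bool" (infix "\<prec>" 50) where
  "\<sigma> \<prec> \<pi> \<longleftrightarrow> \<sigma> \<preceq> \<pi> \<and> \<sigma> \<noteq> \<pi>"

lemma pattern_le_length: "\<sigma> \<preceq> \<pi> \<Longrightarrow> length \<sigma> \<le> length \<pi>"
  unfolding pattern_le_def order_isomorphic_def
  by (metis list_emb_length)

lemma order_isomorphic_perm_eq:
  assumes "is_perm p" "is_perm q" "order_isomorphic p q"
  shows "p = q"
proof (rule nth_equalityI)
  show len: "length p = length q"
    using assms(3) by (simp add: order_isomorphic_def)
  have rank: "card {j. j < length r \<and> r ! j < r ! i} = r ! i - 1"
    if r: "is_perm r" and i: "i < length r" for r i
  proof -
    have inj: "inj_on (nth r) {j. j < length r \<and> r ! j < r ! i}"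
      using r by (auto simp: is_perm_def inj_on_def nth_eq_iff_index_eq)
    have "r ! i \<in> {1..length r}"
      using r i nth_mem unfolding is_perm_def by blast
    moreover have "nth r ` {j. j < length r \<and> r ! j < r ! i} = {v \<in> set r. v < r ! i}"
      by (auto simp: in_set_conv_nth)
    ultimately have "nth r ` {j. j < length r \<and> r ! j < r ! i} = {1..<r ! i}"
      using r by (auto simp: is_perm_def)
    then show ?thesis
      using card_image[OF inj] by simp
  qed
  fix i assume i: "i < length p"
  have "{j. j < length p \<and> p ! j < p ! i} = {j. j < length q \<and> q ! j < q ! i}"
    using assms(3) i by (auto simp: order_isomorphic_def)
  then have "p ! i - 1 = q ! i - 1"
    using rank[OF assms(1) i] rank[OF assms(2)] i len by simp
  moreover have "p ! i \<in> {1..length p}" "q ! i \<in> {1..length q}"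
    using assms(1,2) i len nth_mem unfolding is_perm_def by (blast, metis)
  ultimately show "p ! i = q ! i" by auto
qed

lemma pattern_less_length:
  assumes "is_perm \<tau>" "is_perm \<pi>" "\<tau> \<prec> \<pi>"
  shows "length \<tau> < length \<pi>"
proof (rule ccontr)
  assume "\<not> length \<tau> < length \<pi>"
  moreover obtain xs where xs: "subseq xs \<pi>" "order_isomorphic xs \<tau>"
    using assms(3) by (auto simp: pattern_less_def pattern_le_def)
  ultimately have "length xs = length \<pi>"
    using list_emb_length[OF xs(1)] by (simp add: order_isomorphic_def)
  then have "xs = \<pi>"
    using xs(1) subseq_same_length by blast
  then show False
    using order_isomorphic_perm_eq[OF assms(2,1)] xs(2) assms(3) by (simp add: pattern_less_def)
qed

text \<open>The recursion is meaningful for permutations only; the second component of the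
  termination measure merely makes the function total on arbitrary lists.\<close>

function mobius :: "nat list \<Rightarrow> nat list \<Rightarrow> int" where
  "mobius \<sigma> \<pi> =
     (if \<sigma> = \<pi> then 1
      else if \<not> \<sigma> \<preceq> \<pi> then 0
      else - (\<Sum>\<tau>\<in>{\<tau>. is_perm \<tau> \<and> \<sigma> \<preceq> \<tau> \<and> \<tau> \<prec> \<pi>}. mobius \<sigma> \<tau>))"
  by pat_completeness auto
termination
proof (relation "measures [\<lambda>(\<sigma>, \<pi>). length \<pi>, \<lambda>(\<sigma>, \<pi>). if is_perm \<pi> then 0 else 1]")
  fix \<sigma> \<pi> \<tau> :: "nat list"
  assume "\<tau> \<in> {\<tau>. is_perm \<tau> \<and> \<sigma> \<preceq> \<tau> \<and> \<tau> \<prec> \<pi>}"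
  then have \<tau>: "is_perm \<tau>" "\<tau> \<prec> \<pi>" by auto
  then have "length \<tau> \<le> length \<pi>"
    using pattern_le_length by (auto simp: pattern_less_def)
  then show "((\<sigma>, \<tau>), (\<sigma>, \<pi>)) \<in> measures
      [\<lambda>(\<sigma>, \<pi>). length \<pi>, \<lambda>(\<sigma>, \<pi>). if is_perm \<pi> then 0 else 1]"
    using \<tau> pattern_less_length[of \<tau> \<pi>] by (cases "is_perm \<pi>") auto
qed simp

declare mobius.simps [simp del]

text \<open>The sum above is never affected by the convention for infinite index sets.\<close>

lemma finite_interval: "finite {\<tau>. is_perm \<tau> \<and> \<sigma> \<preceq> \<tau> \<and> \<tau> \<prec> \<pi>}"
proof (rule finite_subset)
  show "{\<tau>. is_perm \<tau> \<and> \<sigma> \<preceq> \<tau> \<and> \<tau> \<prec> \<pi>}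
      \<subseteq> {xs. set xs \<subseteq> {1..length \<pi>} \<and> length xs \<le> length \<pi>}"
    using pattern_le_length by (fastforce simp: is_perm_def pattern_less_def)
  show "finite {xs. set xs \<subseteq> {1..length \<pi>} \<and> length xs \<le> length \<pi>}"
    by (rule finite_lists_length_le) simp
qed

definition balloon2413 :: "nat list \<Rightarrow> nat list" where
  "balloon2413 \<beta> = [2, length \<beta> + 4] @ map (\<lambda>x. x + 2) \<beta> @ [1, length \<beta> + 3]"

definition is_balloon2413 :: "nat list \<Rightarrow> bool" where
  "is_balloon2413 p \<longleftrightarrow> (\<exists>\<gamma>. is_perm \<gamma> \<and> \<gamma> \<noteq> [] \<and> p = balloon2413 \<gamma>)"

end

theory Submission
  imports Defs
begin

text \<open>
  Write \<open>patterns \<tau>\<close> for the set of all permutations contained in \<open>\<tau>\<close>. The recursion for the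
  Moebius function says that \<open>mobius [1]\<close> sums to \<open>0\<close> over \<open>patterns \<tau>\<close> for every permutation \<open>\<tau>\<close>,
  except that the sum is \<open>1\<close> for \<open>\<tau> = [1]\<close> (\<open>pattern_sum_patterns\<close>). The whole proof consists in
  cutting the set of patterns of a balloon into sets of this form.

  A pattern of \<open>balloon2413 \<beta>\<close> either uses all four outer points, and then it is the balloon of a
  pattern of \<open>\<beta>\<close>, or it misses one of them. If one of the outer points is deleted, each
  of the other three is, in a suitable order, a corner point: it is first or last, and smallest or
  largest. So the patterns of the second kind form the union of four sets \<open>patterns \<rho>\<close>, where \<open>\<rho>\<close>
  arises from \<open>\<beta>\<close> by adding three corner points (\<open>patterns_balloon\<close>). Two corners on the same side
  cannot both be occupied in a permutation of length at least two. Therefore the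
  intersections that occur in an inclusion-exclusion over the four sets are again made up of sets
  of patterns of corner extensions of \<open>\<beta>\<close>. All these contribute \<open>0\<close>, and a single term, coming from
  \<open>patterns \<beta>\<close>, survives: the sum over the union is \<open>- 1\<close> if \<open>\<beta> = [1]\<close> and \<open>0\<close> otherwise
  (\<open>pattern_sum_rims\<close>).

  A balloon has no corner point, so it lies in the union only if it lies below \<open>\<beta>\<close>. What is left of
  the vanishing sum over \<open>patterns (balloon2413 \<beta>)\<close> is a recurrence: the values \<open>\<mu>[1, 2413 \<circledcirc> \<gamma>]\<close>,
  summed over those \<open>\<gamma> \<le> \<beta>\<close> for which \<open>2413 \<circledcirc> \<gamma>\<close> is not below \<open>\<beta>\<close>, add up to \<open>1\<close> if \<open>\<beta> = 1\<close> and to \<open>0\<close>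
  otherwise. The empty permutation \<open>\<gamma>\<close>, with balloon \<open>2413\<close>, takes part (\<open>pattern_sum_balloons\<close>).
  The terms excluded by the side condition are the values of \<open>\<mu>[1, \<sigma>]\<close> at the balloons \<open>\<sigma> \<le> \<beta>\<close>.
  Moving them to the other side shows that the function \<open>\<gamma> \<mapsto> \<mu>[1, 2413 \<circledcirc> \<gamma>]\<close> has the same sum over
  every set \<open>patterns \<beta>\<close> as the function that is \<open>2 \<mu>[1, \<sigma>]\<close> at balloons and \<open>\<mu>[1, \<sigma>]\<close> elsewhere, up
  to corrections at the permutations of length at most one. Two functions with equal sums over all
  sets \<open>patterns \<beta>\<close> are equal.
\<close>

section \<open>Standardization\<close>

definition std :: "nat list \<Rightarrow> nat list" where
  "std xs = map (\<lambda>x. card {y \<in> set xs. y \<le> x}) xs"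

text \<open>The empty permutation is included. It carries the Moebius value \<open>0\<close>, so it does not disturb
  sums, and it makes the patterns of a corner extension a union without exceptions.\<close>

definition patterns :: "nat list \<Rightarrow> nat list set" where
  "patterns xs = {\<sigma>. is_perm \<sigma> \<and> \<sigma> \<preceq> xs}"

lemma length_std [simp]: "length (std xs) = length xs"
  by (simp add: std_def)

lemma rank_strict_mono: "strict_mono_on A (\<lambda>x. card {y \<in> A. y \<le> x})" if "finite A" for A :: "nat set"
proof (rule strict_mono_onI)
  fix x z assume "x \<in> A" "z \<in> A" "x < z"
  then have "{y \<in> A. y \<le> x} \<subset> {y \<in> A. y \<le> z}" by force
  then show "card {y \<in> A. y \<le> x} < card {y \<in> A. y \<le> z}"
    using that by (intro psubset_card_mono) auto
qed

lemma rank_bounds: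
  assumes "finite A" "x \<in> A" shows "card {y \<in> A. y \<le> (x::nat)} \<in> {1..card A}"
proof -
  have "card {y \<in> A. y \<le> x} \<le> card A" using assms by (intro card_mono) auto
  moreover have "card {y \<in> A. y \<le> x} > 0" using assms by (auto simp: card_gt_0_iff)
  ultimately show ?thesis by simp
qed

lemma is_perm_std: assumes "distinct xs" shows "is_perm (std xs)"
proof -
  let ?r = "\<lambda>x. card {y \<in> set xs. y \<le> x}"
  have inj: "inj_on ?r (set xs)"
    by (rule strict_mono_on_imp_inj_on[OF rank_strict_mono]) simp
  have "?r ` set xs \<subseteq> {1..length xs}"
    using rank_bounds[of "set xs"] assms by (auto simp: distinct_card)
  moreover have "card (?r ` set xs) = card {1..length xs}"
    using assms card_image[OF inj] by (simp add: distinct_card)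
  ultimately have "?r ` set xs = {1..length xs}"
    by (intro card_subset_eq) auto
  then show ?thesis
    using inj assms by (simp add: is_perm_def std_def distinct_map)
qed

lemma order_isomorphic_map:
  assumes "strict_mono_on (set xs) h" shows "order_isomorphic xs (map h xs)"
  unfolding order_isomorphic_def using strict_mono_on_less[OF assms] by auto

lemma order_isomorphic_std: "order_isomorphic xs (std xs)"
  unfolding std_def by (rule order_isomorphic_map[OF rank_strict_mono]) simp

lemma std_unique:
  assumes "distinct xs" "is_perm \<sigma>" "order_isomorphic xs \<sigma>" shows "\<sigma> = std xs"
proof (rule order_isomorphic_perm_eq)
  show "order_isomorphic \<sigma> (std xs)"
    using assms(3) order_isomorphic_std[of xs] by (auto simp: order_isomorphic_def)
qed (use assms is_perm_std in auto)

lemma std_perm: "is_perm \<sigma> \<Longrightarrow> std \<sigma> = \<sigma>"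
  by (rule std_unique[symmetric]) (auto simp: is_perm_def order_isomorphic_def)

lemma std_map:
  assumes "distinct xs" "strict_mono_on (set xs) h" shows "std (map h xs) = std xs"
proof (rule std_unique)
  show "is_perm (std (map h xs))"
    using assms strict_mono_on_imp_inj_on by (intro is_perm_std) (auto simp: distinct_map)
  show "order_isomorphic xs (std (map h xs))"
    using order_isomorphic_map[OF assms(2)] order_isomorphic_std[of "map h xs"]
    by (auto simp: order_isomorphic_def)
qed fact

lemma std_eqI:
  assumes "distinct xs" "strict_mono_on (set xs) h" "is_perm (map h xs)"
  shows "std xs = map h xs"
  using std_map[OF assms(1,2)] std_perm[OF assms(3)] by simp

lemma subseq_subset: "subseq ys xs \<Longrightarrow> set ys \<subseteq> set xs"
  by (auto simp: subseq_conv_nths dest: in_set_nthsD)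

lemma subseq_Cons_iff: "subseq ys (x # xs) \<longleftrightarrow> subseq ys xs \<or> (\<exists>zs. subseq zs xs \<and> ys = x # zs)"
  by (cases ys) (auto dest: subseq_Cons')

lemma subseq_snoc_iff: "subseq ys (xs @ [x]) \<longleftrightarrow> subseq ys xs \<or> (\<exists>zs. subseq zs xs \<and> ys = zs @ [x])"
proof -
  have "subseq zs [x] \<longleftrightarrow> zs = [] \<or> zs = [x]" for zs
    by (cases zs) (auto split: if_splits)
  then have "subseq ys (xs @ [x]) \<longleftrightarrow>
      (\<exists>us vs. ys = us @ vs \<and> subseq us xs \<and> (vs = [] \<or> vs = [x]))"
    by (simp only: subseq_append_iff)
  then show ?thesis by fastforce
qed

lemma distinct_subseq: "subseq ys xs \<Longrightarrow> distinct xs \<Longrightarrow> distinct ys"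
  by (auto simp: subseq_conv_nths)

text \<open>Sets of patterns become images of sets of subsequences, so that they can be computed by
  splitting subsequences.\<close>

lemma patterns_eq: assumes "distinct xs" shows "patterns xs = std ` {ys. subseq ys xs}"
proof -
  have "\<sigma> \<in> std ` {ys. subseq ys xs}" if "is_perm \<sigma>" "subseq ys xs" "order_isomorphic ys \<sigma>" for \<sigma> ys
    using std_unique[OF distinct_subseq[OF that(2) assms] that(1,3)] that(2) by blast
  moreover have "is_perm (std ys) \<and> std ys \<preceq> xs" if "subseq ys xs" for ys
    using is_perm_std[OF distinct_subseq[OF that assms]] order_isomorphic_std that
    by (auto simp: pattern_le_def)
  ultimately show ?thesis by (auto simp: patterns_def pattern_le_def)
qed

lemma subseq_map_iff: "subseq ys (map h xs) \<longleftrightarrow> (\<exists>zs. subseq zs xs \<and> ys = map h zs)"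
  by (auto simp: subseq_conv_nths nths_map)

lemma patterns_map:
  assumes "distinct xs" "strict_mono_on (set xs) h" shows "patterns (map h xs) = patterns xs"
proof -
  have eq: "std (map h zs) = std zs" if "subseq zs xs" for zs
    using that assms by (intro std_map)
      (auto intro: distinct_subseq monotone_on_subset dest: subseq_subset)
  have "distinct (map h xs)"
    using assms strict_mono_on_imp_inj_on by (auto simp: distinct_map)
  then have "patterns (map h xs) = (\<lambda>zs. std (map h zs)) ` {zs. subseq zs xs}"
    by (auto simp: patterns_eq subseq_map_iff)
  also have "\<dots> = std ` {zs. subseq zs xs}" using eq by (intro image_cong) auto
  finally show ?thesis by (simp add: patterns_eq assms(1))
qed

lemma patterns_std: "distinct xs \<Longrightarrow> patterns (std xs) = patterns xs"
  unfolding std_def by (intro patterns_map rank_strict_mono) simp_all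

lemma is_perm_distinct: "is_perm \<sigma> \<Longrightarrow> distinct \<sigma>"
  by (simp add: is_perm_def)

lemma patterns_mono_subseq: "subseq ys xs \<Longrightarrow> distinct xs \<Longrightarrow> patterns ys \<subseteq> patterns xs"
  by (auto simp: patterns_def pattern_le_def intro: subseq_order.trans)

text \<open>A subsequence of \<open>std ys\<close> corresponds to a subsequence of \<open>ys\<close>; this is transitivity of pattern
  containment.\<close>

lemma patterns_mono:
  assumes "is_perm \<tau>" "\<tau> \<in> patterns xs" "distinct xs" shows "patterns \<tau> \<subseteq> patterns xs"
proof -
  obtain ys where "subseq ys xs" "\<tau> = std ys" using assms by (auto simp: patterns_eq)
  then show ?thesis
    using patterns_std[of ys] patterns_mono_subseq distinct_subseq assms(3) by metis
qed

lemma pattern_le_trans: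
  assumes "is_perm \<sigma>" "is_perm \<tau>" "is_perm \<pi>" "\<sigma> \<preceq> \<tau>" "\<tau> \<preceq> \<pi>" shows "\<sigma> \<preceq> \<pi>"
  using patterns_mono[of \<tau> \<pi>] assms is_perm_distinct by (auto simp: patterns_def)

lemma pattern_le_refl [simp]: "\<sigma> \<preceq> \<sigma>"
  by (auto simp: pattern_le_def order_isomorphic_def)

lemma finite_patterns: "distinct xs \<Longrightarrow> finite (patterns xs)"
proof -
  have "{ys. subseq ys xs} = set (subseqs xs)" by (simp add: set_subseqs_eq)
  then show "distinct xs \<Longrightarrow> finite (patterns xs)" by (simp add: patterns_eq)
qed

lemma is_perm_Nil [simp]: "is_perm []"
  by (simp add: is_perm_def)

lemma Nil_pattern_le [simp]: "[] \<preceq> xs"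
  by (auto simp: pattern_le_def order_isomorphic_def)

lemma singleton_pattern_le [simp]: "[Suc 0] \<preceq> xs \<longleftrightarrow> xs \<noteq> []"
proof
  assume "xs \<noteq> []"
  then have "subseq [hd xs] xs" by (cases xs) auto
  then show "[Suc 0] \<preceq> xs" by (auto simp: pattern_le_def order_isomorphic_def)
qed (auto dest: pattern_le_length)

section \<open>Corner points\<close>

text \<open>The direct and skew sums of a permutation with a single point, on either side. The flags
  say whether the new point is leftmost (otherwise rightmost) and lowest (otherwise highest), so that
  opposite corners differ in both flags and adjacent corners in exactly one.\<close>

definition corner :: "bool \<Rightarrow> bool \<Rightarrow> nat list \<Rightarrow> nat list" where
  "corner left low \<tau> =
     (let v = (if low then 1 else length \<tau> + 1); \<tau>' = (if low then map Suc \<tau> else \<tau>)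
      in if left then v # \<tau>' else \<tau>' @ [v])"

abbreviation "SW \<equiv> corner True True"
abbreviation "NW \<equiv> corner True False"
abbreviation "SE \<equiv> corner False True"
abbreviation "NE \<equiv> corner False False"

lemma std_corner:
  assumes "distinct xs" and "\<forall>x\<in>set xs. if low then v < x else x < v"
  shows "std (if left then v # xs else xs @ [v]) = corner left low (std xs)"
proof -
  have v: "card {y \<in> insert v (set xs). y \<le> v} = (if low then 1 else length xs + 1)"
  proof (cases low)
    case True
    then have "{y \<in> insert v (set xs). y \<le> v} = {v}" using assms by auto
    with True show ?thesis by simp
  next
    case False
    then have "{y \<in> insert v (set xs). y \<le> v} = insert v (set xs)" using assms by auto
    moreover have "v \<notin> set xs" using assms False by auto
    ultimately show ?thesis using False assms by (simp add: distinct_card)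
  qed
  have x: "card {y \<in> insert v (set xs). y \<le> x} =
      (if low then Suc (card {y \<in> set xs. y \<le> x}) else card {y \<in> set xs. y \<le> x})"
    if "x \<in> set xs" for x
  proof (cases low)
    case True
    then have "{y \<in> insert v (set xs). y \<le> x} = insert v {y \<in> set xs. y \<le> x}" "v \<notin> set xs"
      using assms that by auto
    with True show ?thesis by simp
  next
    case False
    then have "{y \<in> insert v (set xs). y \<le> x} = {y \<in> set xs. y \<le> x}" 
      using assms that by auto
    with False show ?thesis by simp
  qed
  show ?thesis
    using v x by (auto simp: std_def corner_def Let_def)
qed

lemma
  assumes "distinct xs"
  shows std_SW: "\<forall>x\<in>set xs. v < x \<Longrightarrow> std (v # xs) = SW (std xs)"
    and std_NW: "\<forall>x\<in>set xs. x < v \<Longrightarrow> std (v # xs) = NW (std xs)"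
    and std_SE: "\<forall>x\<in>set xs. v < x \<Longrightarrow> std (xs @ [v]) = SE (std xs)"
    and std_NE: "\<forall>x\<in>set xs. x < v \<Longrightarrow> std (xs @ [v]) = NE (std xs)"
  using std_corner[OF assms, of True v True] std_corner[OF assms, of False v True]
    std_corner[OF assms, of True v False] std_corner[OF assms, of False v False] by simp_all

lemma length_corner [simp]: "length (corner l v \<tau>) = Suc (length \<tau>)"
  by (simp add: corner_def Let_def)

lemma corner_not_Nil [simp]: "corner l v \<tau> \<noteq> []"
  by (simp add: corner_def Let_def)

lemma corner_inject [simp]: "corner l v \<sigma> = corner l v \<tau> \<longleftrightarrow> \<sigma> = \<tau>"
  by (auto simp: corner_def Let_def inj_map_eq_map split: if_splits)

lemma is_perm_corner_iff [simp]: "is_perm (corner l v \<tau>) \<longleftrightarrow> is_perm \<tau>"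
proof -
  have low: "insert 1 (Suc ` A) = {1..Suc n} \<longleftrightarrow> A = {1..n}" if "0 \<notin> A" for A n
  proof -
    have "{1..Suc n} = insert 1 (Suc ` {1..n})" by (auto simp: image_Suc_atLeastAtMost)
    moreover have "1 \<notin> Suc ` A" "1 \<notin> Suc ` {1..n}" using that by auto
    ultimately show ?thesis by (metis insert_ident inj_image_eq_iff inj_Suc)
  qed
  have high: "insert (Suc n) A = {1..Suc n} \<longleftrightarrow> A = {1..n}" if "Suc n \<notin> A" for A n
  proof -
    have "{1..Suc n} = insert (Suc n) {1..n}" by auto
    then show ?thesis using that by (metis atLeastAtMost_iff insert_ident not_less_eq_eq order_refl)
  qed
  have "distinct (1 # map Suc \<tau>) \<and> set (1 # map Suc \<tau>) = {1..Suc (length \<tau>)} \<longleftrightarrow> is_perm \<tau>"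
  proof (cases "0 \<in> set \<tau>")
    case True
    then show ?thesis by (auto simp: is_perm_def)
  next
    case False
    then have "1 \<notin> set (map Suc \<tau>)" by auto
    then show ?thesis using low[OF False, of "length \<tau>"] by (simp add: is_perm_def distinct_map)
  qed
  moreover have "distinct (Suc (length \<tau>) # \<tau>) \<and> set (Suc (length \<tau>) # \<tau>) = {1..Suc (length \<tau>)}
      \<longleftrightarrow> is_perm \<tau>"
  proof (cases "Suc (length \<tau>) \<in> set \<tau>")
    case True
    then have "set \<tau> \<noteq> {1..length \<tau>}" by auto
    with True show ?thesis by (simp add: is_perm_def)
  next
    case False
    then show ?thesis using high[OF False] by (simp add: is_perm_def)
  qed
  moreover have "is_perm (corner l v \<tau>) \<longleftrightarrow> (if v
      then distinct (1 # map Suc \<tau>) \<and> set (1 # map Suc \<tau>) = {1..Suc (length \<tau>)}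
      else distinct (Suc (length \<tau>) # \<tau>) \<and> set (Suc (length \<tau>) # \<tau>) = {1..Suc (length \<tau>)})"
    by (cases l) (auto simp: corner_def is_perm_def)
  ultimately show ?thesis by presburger
qed

text \<open>An occurrence of a pattern uses the corner point or avoids it; if it uses it, the point
  stays extreme in the pattern.\<close>

lemma patterns_corner:
  assumes "is_perm \<tau>"
  shows "patterns (corner l v \<tau>) = patterns \<tau> \<union> corner l v ` patterns \<tau>"
proof -
  define w where "w = (if v then 1 else length \<tau> + 1)"
  define \<tau>' where "\<tau>' = (if v then map Suc \<tau> else \<tau>)"
  have c: "corner l v \<tau> = (if l then w # \<tau>' else \<tau>' @ [w])"
    by (simp add: corner_def w_def \<tau>'_def Let_def)
  have ext: "\<forall>x\<in>set \<tau>'. if v then w < x else x < w"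
    using assms by (auto simp: w_def \<tau>'_def is_perm_def)
  have dist: "distinct \<tau>'" "distinct \<tau>" using assms by (auto simp: \<tau>'_def is_perm_def distinct_map)
  have pat: "patterns \<tau>' = patterns \<tau>"
    using dist patterns_map[of \<tau> Suc] by (auto simp: \<tau>'_def strict_mono_on_def)
  have sub: "subseq ys (corner l v \<tau>) \<longleftrightarrow>
      subseq ys \<tau>' \<or> (\<exists>zs. subseq zs \<tau>' \<and> ys = (if l then w # zs else zs @ [w]))" for ys
    unfolding c by (simp add: subseq_Cons_iff subseq_snoc_iff)
  have std: "std (if l then w # zs else zs @ [w]) = corner l v (std zs)" if "subseq zs \<tau>'" for zs
    using ext dist(1) distinct_subseq[OF that] subseq_subset[OF that] by (intro std_corner) auto
  have "patterns (corner l v \<tau>) = std ` {ys. subseq ys (corner l v \<tau>)}"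
    using assms by (intro patterns_eq is_perm_distinct) simp
  also have "\<dots> = std ` {ys. subseq ys \<tau>'} \<union>
      (\<lambda>zs. std (if l then w # zs else zs @ [w])) ` {zs. subseq zs \<tau>'}"
    unfolding sub by blast
  also have "\<dots> = patterns \<tau>' \<union> corner l v ` patterns \<tau>'"
    unfolding patterns_eq[OF dist(1)] image_image using std
    by (intro arg_cong2[where f = "(\<union>)"] image_cong) auto
  finally show ?thesis using pat by simp
qed

lemma pattern_le_corner_iff:
  assumes "is_perm \<sigma>" "is_perm \<tau>"
  shows "\<sigma> \<preceq> corner l v \<tau> \<longleftrightarrow> \<sigma> \<preceq> \<tau> \<or> (\<exists>\<rho>. is_perm \<rho> \<and> \<sigma> = corner l v \<rho> \<and> \<rho> \<preceq> \<tau>)"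
proof -
  have "\<sigma> \<in> patterns (corner l v \<tau>) \<longleftrightarrow> \<sigma> \<in> patterns \<tau> \<union> corner l v ` patterns \<tau>"
    using patterns_corner[OF assms(2)] by simp
  then show ?thesis using assms by (auto simp: patterns_def image_iff)
qed

lemma pattern_le_cornerI [intro]: "is_perm \<sigma> \<Longrightarrow> is_perm \<tau> \<Longrightarrow> \<sigma> \<preceq> \<tau> \<Longrightarrow> \<sigma> \<preceq> corner l v \<tau>"
  by (simp add: pattern_le_corner_iff)

lemma corner_pattern_leD: "corner l v \<sigma> \<preceq> \<tau> \<Longrightarrow> is_perm \<sigma> \<Longrightarrow> is_perm \<tau> \<Longrightarrow> \<sigma> \<preceq> \<tau>"
  using pattern_le_trans[of \<sigma> "corner l v \<sigma>" \<tau>] pattern_le_cornerI[of \<sigma> \<sigma> l v] by simp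

lemma corner_le_same_corner_iff:
  assumes "is_perm \<sigma>" "is_perm \<tau>"
  shows "corner l v \<sigma> \<preceq> corner l v \<tau> \<longleftrightarrow> \<sigma> \<preceq> \<tau>"
  using assms by (auto simp: pattern_le_corner_iff dest: corner_pattern_leD)

lemma hd_last_corner:
  "(if l then hd (corner l v \<tau>) else last (corner l v \<tau>)) = (if v then 1 else length \<tau> + 1)"
  by (simp add: corner_def Let_def)

lemma corner_Nil: "corner l v [] = [Suc 0]"
  by (simp add: corner_def)

text \<open>Adjacent corners share a side: a point in both is the only point. In
  the remaining case one value would be both first and last in a distinct list.\<close>

lemma corner_eq_adjacent_corner:
  assumes "is_perm \<sigma>" "(l = l') \<noteq> (v = v')" "corner l v \<sigma> = corner l' v' \<tau>"
  shows "\<sigma> = []"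
proof (cases "l = l'")
  case True
  have "length \<sigma> = length \<tau>" using assms(3) by (metis length_corner nat.inject)
  then show ?thesis
    using True assms(2,3) hd_last_corner[of l v \<sigma>] hd_last_corner[of l' v' \<tau>]
    by (auto split: if_splits)
next
  case False
  have len: "length \<sigma> = length \<tau>" using assms(3) by (metis length_corner nat.inject)
  then have "hd (corner l v \<sigma>) = last (corner l v \<sigma>)"
    using False assms(2,3) hd_last_corner[of l v \<sigma>] hd_last_corner[of l' v' \<tau>]
    by (auto split: if_splits)
  moreover have "distinct (corner l v \<sigma>)" using assms(1) by (intro is_perm_distinct) simp
  ultimately have "length (corner l v \<sigma>) = 1"
    by (cases "corner l v \<sigma>") (auto split: if_splits)
  then show ?thesis by simp
qed

lemma corner_le_adjacent_corner_iff:
  assumes "is_perm \<sigma>" "is_perm \<tau>" "\<tau> \<noteq> []" "(l = l') \<noteq> (v = v')"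
  shows "corner l v \<sigma> \<preceq> corner l' v' \<tau> \<longleftrightarrow> corner l v \<sigma> \<preceq> \<tau>"
proof (cases "\<sigma> = []")
  case True
  then show ?thesis using assms by (simp add: corner_Nil)
next
  case False
  then show ?thesis
    using assms corner_eq_adjacent_corner[OF assms(1,4)]
    by (auto simp: pattern_le_corner_iff)
qed

lemma opposite_corners_commute:
  "corner l v (corner (\<not> l) (\<not> v) \<sigma>) = corner (\<not> l) (\<not> v) (corner l v \<sigma>)"
  by (cases l; cases v) (simp_all add: corner_def)

lemma left_corner_eq_right_corner:
  assumes "corner True v \<sigma> = corner False (\<not> v) \<tau>" "\<sigma> \<noteq> []"
  shows "\<exists>\<rho>. \<sigma> = corner False (\<not> v) \<rho> \<and> \<tau> = corner True v \<rho>"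
proof -
  have len: "length \<sigma> = length \<tau>" using assms(1) by (metis length_corner nat.inject)
  then obtain t \<tau>' where \<tau>: "\<tau> = t # \<tau>'" using assms(2) by (cases \<tau>) auto
  show ?thesis
  proof (cases v)
    case True
    then have *: "t = 1" "map Suc \<sigma> = \<tau>' @ [length \<tau> + 1]"
      using assms(1) \<tau> by (auto simp: corner_def)
    from *(2) obtain \<rho> where "\<sigma> = \<rho> @ [length \<tau>]" "\<tau>' = map Suc \<rho>"
      by (auto simp: map_eq_append_conv)
    then show ?thesis using True \<tau> * by (auto simp: corner_def)
  next
    case False
    then show ?thesis using assms(1) \<tau> len by (auto simp: corner_def)
  qed
qed

lemma corner_eq_opposite_corner:
  assumes "corner l v \<sigma> = corner (\<not> l) (\<not> v) \<tau>" "\<sigma> \<noteq> []"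
  obtains \<rho> where "\<sigma> = corner (\<not> l) (\<not> v) \<rho>" "\<tau> = corner l v \<rho>"
proof (cases l)
  case True
  then show ?thesis using left_corner_eq_right_corner[of v \<sigma> \<tau>] assms that by auto
next
  case False
  have "length \<sigma> = length \<tau>" using assms(1) by (metis length_corner nat.inject)
  then have "\<tau> \<noteq> []" using assms(2) by auto
  then show ?thesis using left_corner_eq_right_corner[of "\<not> v" \<tau> \<sigma>] assms that False by auto
qed

text \<open>Opposite corners can both be occupied, which produces the second disjunct. Together with the
  rules for equal and for adjacent corners, this decides containment between corner extensions by
  peeling off outer points on the right.\<close>

lemma corner_le_opposite_corner_iff:
  assumes "is_perm \<sigma>" "is_perm \<tau>" "\<tau> \<noteq> []"
  shows "corner l v \<sigma> \<preceq> corner (\<not> l) (\<not> v) \<tau> \<longleftrightarrow>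
    corner l v \<sigma> \<preceq> \<tau> \<or> (\<exists>\<rho>. is_perm \<rho> \<and> \<sigma> = corner (\<not> l) (\<not> v) \<rho> \<and> corner l v \<rho> \<preceq> \<tau>)"
proof (cases "\<sigma> = []")
  case True
  then show ?thesis using assms by (simp add: corner_Nil)
next
  case False
  then have "(\<exists>\<rho>'. is_perm \<rho>' \<and> corner l v \<sigma> = corner (\<not> l) (\<not> v) \<rho>' \<and> \<rho>' \<preceq> \<tau>) \<longleftrightarrow>
      (\<exists>\<rho>. is_perm \<rho> \<and> \<sigma> = corner (\<not> l) (\<not> v) \<rho> \<and> corner l v \<rho> \<preceq> \<tau>)"
    by (metis corner_eq_opposite_corner is_perm_corner_iff opposite_corners_commute)
  then show ?thesis using assms by (simp add: pattern_le_corner_iff)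
qed

section \<open>Balloons\<close>

text \<open>What remains of a balloon after deleting, in this order, the outer point that plays the role of
  \<open>1\<close>, \<open>3\<close>, \<open>2\<close> and \<open>4\<close> in \<open>2413\<close>.\<close>

definition rims :: "nat list \<Rightarrow> nat list set" where
  "rims \<beta> = {SW (NW (NE \<beta>)), SE (SW (NW \<beta>)), NW (NE (SE \<beta>)), NE (SE (SW \<beta>))}"

lemma is_perm_balloon [simp]: assumes "is_perm \<beta>" shows "is_perm (balloon2413 \<beta>)"
proof -
  have s: "set \<beta> = {1..length \<beta>}" and d: "distinct \<beta>" using assms by (auto simp: is_perm_def)
  have "(\<lambda>x. x + 2) ` {1..length \<beta>} = {3..length \<beta> + 2}"
    using image_add_atLeastAtMost[of 2 1 "length \<beta>"] by (simp add: numeral_3_eq_3 ac_simps)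
  then have "set (balloon2413 \<beta>) = {1..length \<beta> + 4}"
    unfolding balloon2413_def using s by auto
  moreover have "distinct (balloon2413 \<beta>)"
    unfolding balloon2413_def using d s by (auto simp: distinct_map inj_on_def)
  ultimately show ?thesis by (simp add: is_perm_def balloon2413_def)
qed

lemma length_balloon [simp]: "length (balloon2413 \<beta>) = length \<beta> + 4"
  by (simp add: balloon2413_def)

lemma balloon_inject [simp]: "balloon2413 \<beta> = balloon2413 \<gamma> \<longleftrightarrow> \<beta> = \<gamma>"
  by (auto simp: balloon2413_def inj_map_eq_map inj_def)

text \<open>A balloon starts with \<open>2\<close> and ends with its second largest value, so neither end is extreme.\<close>

lemma balloon_ne_corner [simp]: "balloon2413 \<beta> \<noteq> corner l v \<rho>"
proof
  assume eq: "balloon2413 \<beta> = corner l v \<rho>"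
  then have "length \<rho> = length \<beta> + 3"
    by (auto simp: balloon2413_def dest!: arg_cong[where f = length])
  moreover have "hd (balloon2413 \<beta>) = hd (corner l v \<rho>)" "last (balloon2413 \<beta>) = last (corner l v \<rho>)"
    using eq by auto
  ultimately show False
    by (auto simp: balloon2413_def corner_def Let_def split: if_splits)
qed

text \<open>The left-hand list, a typical subsequence through all four outer points, is standardized by an
  explicit increasing map: it keeps \<open>1\<close> and \<open>2\<close>, lowers the two largest values to lie just above the rest,
  and ranks the shifted entries of \<open>zs\<close> among themselves.\<close>

lemma std_full_balloon:
  assumes "is_perm \<beta>" "subseq zs \<beta>"
  shows "std (2 # (length \<beta> + 4) # map (\<lambda>x. x + 2) zs @ [1, length \<beta> + 3]) = balloon2413 (std zs)"
    (is "std ?xs = _")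
proof -
  define b where "b = length \<beta>"
  define r where "r x = card {y \<in> set zs. y \<le> x}" for x
  define h where "h x = (if x \<le> 2 then x else if x = b + 4 then length zs + 4
    else if x = b + 3 then length zs + 3 else r (x - 2) + 2)" for x
  have zs: "distinct zs" "set zs \<subseteq> {1..b}"
    using assms distinct_subseq subseq_subset by (fastforce simp: is_perm_def b_def)+
  have r: "r x \<in> {1..length zs}" if "x \<in> set zs" for x
    using rank_bounds[of "set zs" x] that zs by (simp add: r_def distinct_card)
  have r_mono: "r x < r y" if "x \<in> set zs" "y \<in> set zs" "x < y" for x y
    using rank_strict_mono[of "set zs"] that by (auto simp: r_def strict_mono_on_def)
  have "distinct ?xs"
    using zs by (auto simp: distinct_map inj_on_def b_def)
  moreover have "strict_mono_on (set ?xs) h"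
  proof (rule strict_mono_onI)
    fix x y assume xy: "x \<in> set ?xs" "y \<in> set ?xs" "x < y"
    have cases: "x \<in> {1, 2, b + 3, b + 4} \<and> h x = (if x \<le> 2 then x else length zs + (x - b)) \<or>
        (\<exists>z\<in>set zs. x = z + 2 \<and> h x = r z + 2)" if "x \<in> set ?xs" for x
      using that zs(2) by (auto simp: h_def b_def)
    from cases[OF xy(1)] cases[OF xy(2)] show "h x < h y"
    proof (elim disjE bexE conjE)
      fix z z' assume "z \<in> set zs" "z' \<in> set zs" "x = z + 2" "y = z' + 2"
        "h x = r z + 2" "h y = r z' + 2"
      then show ?thesis using r_mono[of z z'] xy(3) by simp
    next
      fix z assume "z \<in> set zs" "x = z + 2" "h x = r z + 2"
        "y \<in> {1, 2, b + 3, b + 4}" "h y = (if y \<le> 2 then y else length zs + (y - b))"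
      then show ?thesis using r[of z] zs(2) xy(3) by auto
    next
      fix z assume "z \<in> set zs" "y = z + 2" "h y = r z + 2"
        "x \<in> {1, 2, b + 3, b + 4}" "h x = (if x \<le> 2 then x else length zs + (x - b))"
      then show ?thesis using r[of z] zs(2) xy(3) by auto
    next
      assume "x \<in> {1, 2, b + 3, b + 4}" "h x = (if x \<le> 2 then x else length zs + (x - b))"
        "y \<in> {1, 2, b + 3, b + 4}" "h y = (if y \<le> 2 then y else length zs + (y - b))"
      then show ?thesis using xy(3) by auto
    qed
  qed
  moreover have "map h ?xs = balloon2413 (std zs)"
    using zs(2) by (auto simp: balloon2413_def std_def h_def r_def[abs_def] b_def)
  ultimately show ?thesis
    using std_eqI[of ?xs h] is_perm_std[OF zs(1)] by simp
qed

lemma subseq_balloon_iff: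
  "subseq ys (p # q # B @ [r, s]) \<longleftrightarrow>
    subseq ys (q # B @ [r, s]) \<or> subseq ys (p # B @ [r, s]) \<or>
    subseq ys (p # q # B @ [s]) \<or> subseq ys (p # q # B @ [r]) \<or>
    (\<exists>zs. subseq zs B \<and> ys = p # q # zs @ [r, s])"
  (is "?full \<longleftrightarrow> ?part")
proof
  assume ?full
  then consider "subseq ys (q # B @ [r, s])" | zs where "ys = p # zs" "subseq zs (q # B @ [r, s])"
    by (auto simp: subseq_Cons_iff)
  then show ?part
  proof cases
    case (2 zs)
    then consider "subseq zs (B @ [r, s])" | us where "zs = q # us" "subseq us (B @ [r, s])"
      by (auto simp: subseq_Cons_iff)
    then show ?thesis
    proof cases
      case (2 us)
      have "subseq us (B @ [r]) \<or> subseq us (B @ [s]) \<or> (\<exists>vs. subseq vs B \<and> us = vs @ [r, s])"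
        using 2(2) subseq_snoc_iff[of us "B @ [r]" s]
        by (fastforce dest: subseq_snoc_iff[THEN iffD1])
      then show ?thesis using 2(1) \<open>ys = p # zs\<close> by auto
    qed (use 2 in simp)
  qed simp
next
  have "subseq (q # B @ [r, s]) (p # q # B @ [r, s])" "subseq (p # B @ [r, s]) (p # q # B @ [r, s])"
    "subseq (p # q # B @ [s]) (p # q # B @ [r, s])" "subseq (p # q # B @ [r]) (p # q # B @ [r, s])"
    by (auto simp: subseq_append' list_emb_Cons)
  moreover assume ?part
  ultimately show ?full
    by (elim disjE exE conjE) (auto intro: subseq_order.trans list_emb_append_mono)
qed

lemma patterns_balloon:
  assumes "is_perm \<beta>"
  shows "patterns (balloon2413 \<beta>) = (\<Union>\<tau>\<in>rims \<beta>. patterns \<tau>) \<union> balloon2413 ` patterns \<beta>"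
proof -
  let ?B = "map (\<lambda>x. x + 2) \<beta>" and ?n = "length \<beta>"
  have d: "distinct ?B" and B: "set ?B \<subseteq> {3..?n + 2}"
    using assms by (auto simp: is_perm_def distinct_map inj_on_def)
  have std: "std ?B = \<beta>"
    using std_map[of \<beta> "\<lambda>x. x + 2"] std_perm assms by (auto simp: is_perm_def strict_mono_on_def)
  have dist: "distinct ((?n + 4) # ?B @ [1, ?n + 3])" "distinct (2 # ?B @ [1, ?n + 3])"
    "distinct (2 # (?n + 4) # ?B @ [?n + 3])" "distinct (2 # (?n + 4) # ?B @ [1])"
    using d B by auto
  have NW: "std ((?n + 4) # xs) = NW (std xs)" if "distinct xs" "set xs \<subseteq> {1..?n + 3}" for xs
    using that by (intro std_NW) auto
  have NE: "std (xs @ [?n + 3]) = NE (std xs)" if "distinct xs" "set xs \<subseteq> {1..?n + 2}" for xs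
    using that by (intro std_NE) auto
  have SW: "std (2 # xs) = SW (std xs)" if "distinct xs" "set xs \<subseteq> {3..}" for xs
    using that by (intro std_SW) auto
  have SE: "std (xs @ [1]) = SE (std xs)" if "distinct xs" "set xs \<subseteq> {2..}" for xs
    using that by (intro std_SE) auto
  have B': "set ?B \<subseteq> {3..}" "set ?B \<subseteq> {2..}" "set ?B \<subseteq> {1..?n + 2}" "set ?B \<subseteq> {1..?n + 3}" 
    "?n + 4 \<notin> set ?B" "?n + 3 \<notin> set ?B" "2 \<notin> set ?B" "1 \<notin> set ?B"
    using B by auto
  have "std (((?n + 4) # ?B @ [1]) @ [?n + 3]) = NW (NE (SE \<beta>))"
    using NW[of "(?B @ [1]) @ [?n + 3]"] NE[of "?B @ [1]"] SE[of ?B] d B' std by simp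
  moreover have "std (((2 # ?B) @ [1]) @ [?n + 3]) = NE (SE (SW \<beta>))"
    using NE[of "(2 # ?B) @ [1]"] SE[of "2 # ?B"] SW[of ?B] d B' std by simp
  moreover have "std (2 # (?n + 4) # ?B @ [?n + 3]) = SW (NW (NE \<beta>))"
    using SW[of "(?n + 4) # ?B @ [?n + 3]"] NW[of "?B @ [?n + 3]"] NE[of ?B] d B' std by simp
  moreover have "std ((2 # (?n + 4) # ?B) @ [1]) = SE (SW (NW \<beta>))"
    using SE[of "2 # (?n + 4) # ?B"] SW[of "(?n + 4) # ?B"] NW[of ?B] d B' std by simp
  ultimately have rims: "(\<Union>\<tau>\<in>rims \<beta>. patterns \<tau>) =
      patterns ((?n + 4) # ?B @ [1, ?n + 3]) \<union> patterns (2 # ?B @ [1, ?n + 3]) \<union>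
      patterns (2 # (?n + 4) # ?B @ [?n + 3]) \<union> patterns (2 # (?n + 4) # ?B @ [1])"
    using patterns_std[OF dist(1)] patterns_std[OF dist(2)] patterns_std[OF dist(3)]
      patterns_std[OF dist(4)]
    by (auto simp: rims_def)
  have full: "std (2 # (?n + 4) # map (\<lambda>x. x + 2) zs @ [1, ?n + 3]) = balloon2413 (std zs)"
    if "subseq zs \<beta>" for zs
    by (rule std_full_balloon[OF assms that])
  have "patterns (balloon2413 \<beta>) = std ` {ys. subseq ys (2 # (?n + 4) # ?B @ [1, ?n + 3])}"
    using patterns_eq[OF is_perm_distinct[OF is_perm_balloon[OF assms]]]
    by (simp add: balloon2413_def)
  also have "\<dots> = (\<Union>\<tau>\<in>rims \<beta>. patterns \<tau>) \<union>
      (\<lambda>zs. std (2 # (?n + 4) # map (\<lambda>x. x + 2) zs @ [1, ?n + 3])) ` {zs. subseq zs \<beta>}"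
    unfolding subseq_balloon_iff subseq_map_iff rims
      patterns_eq[OF dist(1)] patterns_eq[OF dist(2)] patterns_eq[OF dist(3)] patterns_eq[OF dist(4)]
    by blast
  also have "(\<lambda>zs. std (2 # (?n + 4) # map (\<lambda>x. x + 2) zs @ [1, ?n + 3])) ` {zs. subseq zs \<beta>} =
      balloon2413 ` patterns \<beta>"
    unfolding patterns_eq[OF is_perm_distinct[OF assms]] image_image
    using full by (intro image_cong) auto
  finally show ?thesis .
qed

section \<open>Intersections of sets of patterns of corner extensions\<close>

text \<open>The rule for opposite corners negates variables; its four instances are usable as rewrite
  rules on the concrete corners.\<close>

lemmas corner_le_opposite =
  corner_le_opposite_corner_iff[where l = True and v = True, simplified]
  corner_le_opposite_corner_iff[where l = True and v = False, simplified]
  corner_le_opposite_corner_iff[where l = False and v = True, simplified]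
  corner_le_opposite_corner_iff[where l = False and v = False, simplified]

definition corner_free :: "nat list \<Rightarrow> bool" where
  "corner_free \<sigma> \<longleftrightarrow> (\<forall>l v \<rho>. \<sigma> \<noteq> corner l v \<rho>)"

lemma corner_free_le_corner_iff:
  "corner_free \<sigma> \<Longrightarrow> is_perm \<sigma> \<Longrightarrow> is_perm \<tau> \<Longrightarrow> \<sigma> \<preceq> corner l v \<tau> \<longleftrightarrow> \<sigma> \<preceq> \<tau>"
  by (auto simp: pattern_le_corner_iff corner_free_def)

lemma corner_free_balloon: "corner_free (balloon2413 \<beta>)"
  by (simp add: corner_free_def)

lemmas corner_le = corner_free_le_corner_iff
  corner_le_same_corner_iff corner_le_adjacent_corner_iff corner_le_opposite

lemma corner_cases [consumes 1]:
  assumes "is_perm \<sigma>"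
    and "is_perm \<sigma> \<Longrightarrow> corner_free \<sigma> \<Longrightarrow> P \<sigma>"
    and "\<And>\<rho>. is_perm \<rho> \<Longrightarrow> P (SW \<rho>)" "\<And>\<rho>. is_perm \<rho> \<Longrightarrow> P (NW \<rho>)"
    and "\<And>\<rho>. is_perm \<rho> \<Longrightarrow> P (SE \<rho>)" "\<And>\<rho>. is_perm \<rho> \<Longrightarrow> P (NE \<rho>)"
  shows "P \<sigma>"
  using assms unfolding corner_free_def by (metis (full_types) is_perm_corner_iff)

lemma patterns_corner_mono: "is_perm \<tau> \<Longrightarrow> patterns \<tau> \<subseteq> patterns (corner l v \<tau>)"
  by (simp add: patterns_corner)

lemma corner_patterns_mono:
  "is_perm \<rho> \<Longrightarrow> is_perm \<tau> \<Longrightarrow> patterns \<rho> \<subseteq> patterns \<tau> \<Longrightarrow>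
    patterns (corner l v \<rho>) \<subseteq> patterns (corner l v \<tau>)"
  by (auto simp: patterns_corner)

lemma patterns_adjacent_corners_Int:
  assumes "is_perm \<tau>" "\<tau> \<noteq> []" "(l = l') \<noteq> (v = v')"
  shows "patterns (corner l v \<tau>) \<inter> patterns (corner l' v' \<tau>) = patterns \<tau>"
proof -
  have "\<sigma> \<preceq> \<tau>" if "is_perm \<sigma>" "\<sigma> \<preceq> corner l v \<tau>" "\<sigma> \<preceq> corner l' v' \<tau>" for \<sigma>
    using that assms corner_le_adjacent_corner_iff[of _ \<tau> l l' v v']
    by (auto simp: pattern_le_corner_iff[of \<sigma> \<tau> l v])
  then show ?thesis
    using patterns_corner_mono[OF assms(1)] by (auto simp: patterns_def)
qed

text \<open>Sets of patterns are closed under removing a corner point. So if \<open>corner l v \<omega>\<close> comes from a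
  pattern \<open>\<omega>\<close> of \<open>\<rho>\<close> and is itself a pattern of \<open>\<tau>\<close>, then \<open>\<omega>\<close> is a common pattern.\<close>

lemma patterns_same_corner_Int:
  assumes "is_perm \<rho>" "is_perm \<tau>"
  shows "patterns (corner l v \<rho>) \<inter> patterns (corner l v \<tau>) =
    (patterns \<rho> \<inter> patterns \<tau>) \<union> corner l v ` (patterns \<rho> \<inter> patterns \<tau>)"
proof -
  have "\<omega> \<in> patterns \<tau>'" if "corner l v \<omega> \<in> patterns \<tau>'" "is_perm \<tau>'" for \<omega> \<tau>'
    using that corner_pattern_leD by (auto simp: patterns_def)
  then show ?thesis using assms by (auto simp: patterns_corner)
qed

text \<open>The nontrivial inclusions below follow one scheme. A pattern \<open>\<sigma>\<close> is corner-free or has one of the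
  four corner points; in each case the peeling rules reduce every containment to one in \<open>\<beta>\<close>, where the
  claim is propositional.\<close>

context
  fixes \<beta> :: "nat list"
  assumes \<beta>: "is_perm \<beta>" "\<beta> \<noteq> []"
begin

lemma west_rims_Int:
  "patterns (SW (NW (NE \<beta>))) \<inter> patterns (SE (SW (NW \<beta>))) = patterns (SW (NW \<beta>))"
proof -
  have "\<sigma> \<preceq> SW (NW \<beta>)"
    if "is_perm \<sigma>" "\<sigma> \<preceq> SW (NW (NE \<beta>)) \<and> \<sigma> \<preceq> SE (SW (NW \<beta>))" for \<sigma>
    using that
    by (induction \<sigma> rule: corner_cases)
      (use \<beta> in \<open>auto simp: corner_le dest: corner_pattern_leD\<close>)
  moreover have "patterns (SW (NW \<beta>)) \<subseteq> patterns (SW (NW (NE \<beta>)))"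
    by (intro corner_patterns_mono patterns_corner_mono) (use \<beta> in auto)
  ultimately show ?thesis
    using \<beta> patterns_corner_mono[of "SW (NW \<beta>)"] by (auto simp: patterns_def)
qed

lemma east_rims_Int:
  "patterns (NE (SE (SW \<beta>))) \<inter> patterns (NW (NE (SE \<beta>))) = patterns (NE (SE \<beta>))"
proof -
  have "\<sigma> \<preceq> NE (SE \<beta>)"
    if "is_perm \<sigma>" "\<sigma> \<preceq> NE (SE (SW \<beta>)) \<and> \<sigma> \<preceq> NW (NE (SE \<beta>))" for \<sigma>
    using that
    by (induction \<sigma> rule: corner_cases)
      (use \<beta> in \<open>auto simp: corner_le dest: corner_pattern_leD\<close>)
  moreover have "patterns (NE (SE \<beta>)) \<subseteq> patterns (NE (SE (SW \<beta>)))"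
    by (intro corner_patterns_mono patterns_corner_mono) (use \<beta> in auto)
  ultimately show ?thesis
    using \<beta> patterns_corner_mono[of "NE (SE \<beta>)"] by (auto simp: patterns_def)
qed

text \<open>The rims are paired by a common neighbouring pair of corners: the first two meet in
  the western pair \<open>SW\<close>, \<open>NW\<close> and the other two in the eastern pair. This pairing keeps every
  intersection a union of sets of patterns of corner extensions. Taken individually, two rims whose
  deleted points are opposite do not meet so well: \<open>SW (NW (NE \<beta>))\<close> and \<open>NE (SE (SW \<beta>))\<close>, for
  example, both contain \<open>NW (SE \<omega>)\<close> whenever \<open>NW \<omega>\<close> and \<open>SE \<omega>\<close> are patterns of \<open>\<beta>\<close>.\<close>

lemma west_east_rims_Int:
  "(patterns (SW (NW (NE \<beta>))) \<union> patterns (SE (SW (NW \<beta>)))) \<inter>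
   (patterns (NE (SE (SW \<beta>))) \<union> patterns (NW (NE (SE \<beta>)))) =
   (patterns (NW (NE \<beta>)) \<union> patterns (NW (SE \<beta>))) \<union>
   (patterns (SE (SW \<beta>)) \<union> patterns (NE (SW \<beta>)))" (is "?L = ?R")
proof
  have "(\<sigma> \<preceq> NW (NE \<beta>) \<or> \<sigma> \<preceq> NW (SE \<beta>)) \<or> (\<sigma> \<preceq> SE (SW \<beta>) \<or> \<sigma> \<preceq> NE (SW \<beta>))"
    if "is_perm \<sigma>" "(\<sigma> \<preceq> SW (NW (NE \<beta>)) \<or> \<sigma> \<preceq> SE (SW (NW \<beta>))) \<and>
      (\<sigma> \<preceq> NE (SE (SW \<beta>)) \<or> \<sigma> \<preceq> NW (NE (SE \<beta>)))" for \<sigma>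
    using that
    by (induction \<sigma> rule: corner_cases)
      (use \<beta> in \<open>auto simp: corner_le dest: corner_pattern_leD\<close>)
  then show "?L \<subseteq> ?R" by (auto simp: patterns_def)
  have commute: "SE (NW \<beta>) = NW (SE \<beta>)" "SW (NE \<beta>) = NE (SW \<beta>)"
    using opposite_corners_commute[of False True] opposite_corners_commute[of True True] by simp_all
  have "patterns (NW (NE \<beta>)) \<subseteq> patterns (SW (NW (NE \<beta>)))"
    "patterns (NW (NE \<beta>)) \<subseteq> patterns (NW (NE (SE \<beta>)))"
    "patterns (SE (NW \<beta>)) \<subseteq> patterns (SE (SW (NW \<beta>)))"
    "patterns (NW (SE \<beta>)) \<subseteq> patterns (NW (NE (SE \<beta>)))"
    "patterns (SE (SW \<beta>)) \<subseteq> patterns (SE (SW (NW \<beta>)))"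
    "patterns (SE (SW \<beta>)) \<subseteq> patterns (NE (SE (SW \<beta>)))"
    "patterns (SW (NE \<beta>)) \<subseteq> patterns (SW (NW (NE \<beta>)))"
    "patterns (NE (SW \<beta>)) \<subseteq> patterns (NE (SE (SW \<beta>)))"
    by (intro corner_patterns_mono patterns_corner_mono; use \<beta> in simp)+
  then show "?R \<subseteq> ?L" unfolding commute by blast
qed

lemma corner_pairs_Int:
  "(patterns (NW (NE \<beta>)) \<union> patterns (NW (SE \<beta>))) \<inter>
   (patterns (SE (SW \<beta>)) \<union> patterns (NE (SW \<beta>))) = patterns (NE \<beta>) \<union> patterns (SE \<beta>)"
    (is "?L = ?R")
proof
  have "\<sigma> \<preceq> NE \<beta> \<or> \<sigma> \<preceq> SE \<beta>"
    if "is_perm \<sigma>" "(\<sigma> \<preceq> NW (NE \<beta>) \<or> \<sigma> \<preceq> NW (SE \<beta>)) \<and> (\<sigma> \<preceq> SE (SW \<beta>) \<or> \<sigma> \<preceq> NE (SW \<beta>))" for \<sigma>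
    using that
    by (induction \<sigma> rule: corner_cases)
      (use \<beta> in \<open>auto simp: corner_le dest: corner_pattern_leD\<close>)
  then show "?L \<subseteq> ?R" by (auto simp: patterns_def)
  have commute: "SE (NW \<beta>) = NW (SE \<beta>)" "SW (NE \<beta>) = NE (SW \<beta>)"
    using opposite_corners_commute[of False True] opposite_corners_commute[of True True] by simp_all
  have "patterns (NE \<beta>) \<subseteq> patterns (NW (NE \<beta>))" "patterns (NE \<beta>) \<subseteq> patterns (SW (NE \<beta>))"
    "patterns (SE \<beta>) \<subseteq> patterns (NW (SE \<beta>))" "patterns (SE \<beta>) \<subseteq> patterns (SE (SW \<beta>))"
    by (intro corner_patterns_mono patterns_corner_mono; use \<beta> in simp)+
  then show "?R \<subseteq> ?L" unfolding commute by blast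
qed

end

section \<open>The Moebius function as an inverse\<close>

abbreviation pattern_sum :: "nat list set \<Rightarrow> int" where
  "pattern_sum S \<equiv> (\<Sum>\<sigma>\<in>S. mobius [Suc 0] \<sigma>)"

lemma mobius_Nil [simp]: "mobius [Suc 0] [] = 0"
  by (subst mobius.simps) simp

text \<open>The recursion for the Moebius function, extended over all patterns: the only pattern that does
  not contain \<open>[1]\<close> is the empty one, where the value is \<open>0\<close>.\<close>

lemma pattern_sum_patterns:
  assumes "is_perm \<tau>"
  shows "pattern_sum (patterns \<tau>) = (if \<tau> = [1] then 1 else 0)"
proof -
  let ?I = "{\<sigma>. is_perm \<sigma> \<and> [Suc 0] \<preceq> \<sigma> \<and> \<sigma> \<prec> \<tau>}"
  have "patterns \<tau> = insert [] (insert \<tau> ?I)"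
    using assms by (auto simp: patterns_def pattern_less_def)
  moreover have "finite ?I" by (rule finite_interval)
  moreover have "\<tau> \<notin> ?I" "[] \<notin> ?I" by (auto simp: pattern_less_def)
  ultimately have sum: "pattern_sum (patterns \<tau>) =
      (if \<tau> = [] then 0 else mobius [Suc 0] \<tau>) + pattern_sum ?I"
    by (cases "\<tau> = []") (simp_all add: insert_absorb)
  consider "\<tau> = []" | "\<tau> = [1]" | "\<tau> \<noteq> []" "\<tau> \<noteq> [1]" by blast
  then show ?thesis
  proof cases
    case 1
    then have "patterns \<tau> = {[]}" by (auto simp: patterns_def dest: pattern_le_length)
    then show ?thesis using 1 by simp
  next
    case 2
    have I: "?I = {}"
      using pattern_less_length[OF _ assms] 2 by (auto; fastforce)
    have "mobius [Suc 0] [Suc 0] = 1" by (subst mobius.simps) simp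
    then show ?thesis using sum[unfolded I] 2 by simp
  next
    case 3
    have "mobius [Suc 0] \<tau> = - pattern_sum ?I"
      using 3 by (subst mobius.simps) auto
    then show ?thesis using sum 3 by simp
  qed
qed

lemma pattern_sum_Un:
  "finite A \<Longrightarrow> finite B \<Longrightarrow> pattern_sum (A \<union> B) = pattern_sum A + pattern_sum B - pattern_sum (A \<inter> B)"
  using sum.union_inter[of A B "mobius [Suc 0]"] by simp

text \<open>Three rounds of inclusion-exclusion for two sets. In each of them only the intersection
  contributes, with a change of sign; it is passed on to the next round, and the last one is
  \<open>patterns \<beta>\<close>.\<close>

lemma pattern_sum_rims:
  assumes "is_perm \<beta>" "\<beta> \<noteq> []"
  shows "pattern_sum (\<Union>\<tau>\<in>rims \<beta>. patterns \<tau>) = (if \<beta> = [1] then - 1 else 0)"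
proof -
  have fin [simp]: "finite (patterns (corner l v \<tau>))" if "is_perm \<tau>" for l v \<tau>
    using that by (intro finite_patterns is_perm_distinct) simp
  have zero [simp]: "pattern_sum (patterns (corner l v \<tau>)) = 0" if "is_perm \<tau>" "\<tau> \<noteq> []" for l v \<tau>
    using that by (subst pattern_sum_patterns) (auto dest: arg_cong[where f = length])
  have "pattern_sum (patterns (NE \<beta>) \<union> patterns (SE \<beta>)) = - pattern_sum (patterns \<beta>)"
    using assms by (simp add: pattern_sum_Un patterns_adjacent_corners_Int)
  moreover have "pattern_sum (patterns (SE (SW \<beta>)) \<union> patterns (NE (SW \<beta>))) = 0"
    using assms by (simp add: pattern_sum_Un patterns_adjacent_corners_Int)
  moreover have "patterns (NW (NE \<beta>)) \<inter> patterns (NW (SE \<beta>)) = patterns (NW \<beta>)"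
    using assms patterns_same_corner_Int[of "NE \<beta>" "SE \<beta>"]
    by (simp add: patterns_adjacent_corners_Int patterns_corner[OF assms(1), of True False])
  then have "pattern_sum (patterns (NW (NE \<beta>)) \<union> patterns (NW (SE \<beta>))) = 0"
    using assms by (simp add: pattern_sum_Un)
  ultimately have pairs: "pattern_sum ((patterns (NW (NE \<beta>)) \<union> patterns (NW (SE \<beta>))) \<union>
      (patterns (SE (SW \<beta>)) \<union> patterns (NE (SW \<beta>)))) = pattern_sum (patterns \<beta>)"
    using assms by (subst pattern_sum_Un) (simp_all add: corner_pairs_Int)
  have west: "pattern_sum (patterns (SW (NW (NE \<beta>))) \<union> patterns (SE (SW (NW \<beta>)))) = 0"
    and east: "pattern_sum (patterns (NE (SE (SW \<beta>))) \<union> patterns (NW (NE (SE \<beta>)))) = 0"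
    using assms by (simp_all add: pattern_sum_Un west_rims_Int east_rims_Int)
  have "(\<Union>\<tau>\<in>rims \<beta>. patterns \<tau>) =
      (patterns (SW (NW (NE \<beta>))) \<union> patterns (SE (SW (NW \<beta>)))) \<union>
      (patterns (NE (SE (SW \<beta>))) \<union> patterns (NW (NE (SE \<beta>))))"
    by (auto simp: rims_def)
  then have "pattern_sum (\<Union>\<tau>\<in>rims \<beta>. patterns \<tau>) = - pattern_sum (patterns \<beta>)"
    using west east pairs assms by (simp add: pattern_sum_Un west_east_rims_Int)
  then show ?thesis using assms by (simp add: pattern_sum_patterns)
qed

lemma balloon_in_rims_iff:
  assumes "is_perm \<beta>" "is_perm \<gamma>"
  shows "balloon2413 \<gamma> \<in> (\<Union>\<tau>\<in>rims \<beta>. patterns \<tau>) \<longleftrightarrow> balloon2413 \<gamma> \<preceq> \<beta>"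
  using assms by (simp add: rims_def patterns_def corner_free_le_corner_iff corner_free_balloon)

text \<open>The sum over all patterns of the balloon vanishes, and the rims cover everything except the
  balloons of those \<open>\<gamma>\<close> for which \<open>balloon2413 \<gamma>\<close> is not already contained in \<open>\<beta>\<close>.\<close>

lemma pattern_sum_balloons:
  assumes "is_perm \<beta>" "\<beta> \<noteq> []"
  shows "(\<Sum>\<gamma>\<in>{\<gamma> \<in> patterns \<beta>. \<not> balloon2413 \<gamma> \<preceq> \<beta>}. mobius [Suc 0] (balloon2413 \<gamma>)) =
    (if \<beta> = [1] then 1 else 0)"
proof -
  let ?U = "\<Union>\<tau>\<in>rims \<beta>. patterns \<tau>" and ?N = "{\<gamma> \<in> patterns \<beta>. \<not> balloon2413 \<gamma> \<preceq> \<beta>}"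
  have fin: "finite ?U" "finite (balloon2413 ` ?N)"
    using assms finite_patterns is_perm_distinct by (auto simp: rims_def)
  have "balloon2413 \<gamma> \<in> ?U \<longleftrightarrow> balloon2413 \<gamma> \<preceq> \<beta>" if "\<gamma> \<in> patterns \<beta>" for \<gamma>
    using balloon_in_rims_iff assms(1) that by (simp add: patterns_def)
  then have split: "patterns (balloon2413 \<beta>) = ?U \<union> balloon2413 ` ?N" "?U \<inter> balloon2413 ` ?N = {}"
    unfolding patterns_balloon[OF assms(1)] by blast+
  have "pattern_sum (patterns (balloon2413 \<beta>)) = pattern_sum ?U + pattern_sum (balloon2413 ` ?N)"
    unfolding split(1) by (rule sum.union_disjoint[OF fin split(2)])
  moreover have "pattern_sum (patterns (balloon2413 \<beta>)) = 0"
    using assms by (auto simp: pattern_sum_patterns dest: arg_cong[where f = length])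
  moreover have "pattern_sum (balloon2413 ` ?N) = (\<Sum>\<gamma>\<in>?N. mobius [Suc 0] (balloon2413 \<gamma>))"
    by (subst sum.reindex) (auto simp: inj_on_def)
  ultimately show ?thesis using pattern_sum_rims[OF assms] by (simp split: if_splits)
qed

text \<open>The start of the recurrence. The empty \<open>\<beta>\<close> is out of reach of \<open>pattern_sum_balloons\<close>, since
  adjacent corner extensions of the empty permutation coincide; the eight permutations below
  \<open>2413\<close> are few enough to sum directly.\<close>

lemma mobius_2413: "mobius [Suc 0] (balloon2413 []) = - 3"
proof -
  have Nil: "patterns [] = {[]}" by (auto simp: patterns_def dest: pattern_le_length)
  note pats = patterns_corner Nil
  note entries = corner_def balloon2413_def eval_nat_numeral sum.insert_if
  have sum: "pattern_sum (patterns \<tau>) = 0" if "is_perm \<tau>" "length \<tau> \<ge> 2" for \<tau>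
    using that by (auto simp: pattern_sum_patterns)
  have 1: "pattern_sum (patterns (SW [])) = 1"
    by (subst pattern_sum_patterns) (simp, simp add: corner_Nil)
  have m1: "mobius [Suc 0] [1] = 1"
    using 1 by (simp add: pats, simp add: entries)
  have m12: "mobius [Suc 0] [1, 2] = - 1" and m21: "mobius [Suc 0] [2, 1] = - 1"
    using sum[of "SW (SW [])", simplified] sum[of "SE (SW [])", simplified] m1
    by (simp_all add: pats, simp_all add: entries)
  have m3: "mobius [Suc 0] [1, 3, 2] = 1" "mobius [Suc 0] [2, 3, 1] = 1"
     "mobius [Suc 0] [3, 1, 2] = 1" "mobius [Suc 0] [2, 1, 3] = 1"
    using sum[of "SW (NW (NE []))", simplified] sum[of "SE (SW (NW []))", simplified]
      sum[of "NW (NE (SE []))", simplified] sum[of "NE (SE (SW []))", simplified] m1 m12 m21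
    by (simp_all add: pats, simp_all add: entries)
  show ?thesis
    using sum[OF is_perm_balloon[OF is_perm_Nil]] m1 m12 m21 m3
    by (simp add: patterns_balloon rims_def pats, simp add: entries)
qed

text \<open>The claimed value in a form that sums well. Here \<open>2413\<close>, the balloon of the empty permutation,
  counts as a balloon; this explains its exceptional value \<open>- 6\<close> as \<open>2 * (- 3)\<close>. The
  corrections \<open>3\<close> at \<open>[1]\<close> and \<open>- 3\<close> at \<open>[]\<close> cancel in the sum over the patterns of any nonempty
  permutation.\<close>

definition balloon_value :: "nat list \<Rightarrow> int" where
  "balloon_value \<beta> = mobius [Suc 0] \<beta> +
    (if \<beta> \<in> balloon2413 ` Collect is_perm then mobius [Suc 0] \<beta> else 0) +
    (if \<beta> = [1] then 3 else 0) - (if \<beta> = [] then 3 else 0)"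

lemma pattern_le_balloon: assumes "is_perm \<beta>" shows "\<beta> \<preceq> balloon2413 \<beta>"
proof -
  have "\<beta> \<in> patterns (SW (NW (NE \<beta>)))"
    using assms by (simp add: patterns_def pattern_le_corner_iff)
  then show ?thesis
    using patterns_balloon[OF assms] by (auto simp: rims_def patterns_def)
qed

text \<open>The doubled values at the balloons below \<open>\<beta>\<close> supply exactly the terms that the recurrence leaves
  out, because \<open>balloon2413 \<gamma> \<preceq> \<beta>\<close> forces \<open>\<gamma> \<preceq> \<beta>\<close>.\<close>

lemma sum_balloon_value:
  assumes "is_perm \<beta>" "\<beta> \<noteq> []"
  shows "(\<Sum>\<sigma>\<in>patterns \<beta>. balloon_value \<sigma>) = (\<Sum>\<sigma>\<in>patterns \<beta>. mobius [Suc 0] (balloon2413 \<sigma>))"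
proof -
  have fin: "finite (patterns \<beta>)" using assms(1) by (intro finite_patterns is_perm_distinct)
  let ?In = "{\<gamma> \<in> patterns \<beta>. balloon2413 \<gamma> \<preceq> \<beta>}" and ?N = "{\<gamma> \<in> patterns \<beta>. \<not> balloon2413 \<gamma> \<preceq> \<beta>}"
  have units: "[] \<in> patterns \<beta>" "[Suc 0] \<in> patterns \<beta>"
    using assms by (auto simp: patterns_def is_perm_def)
  have "\<gamma> \<preceq> \<beta>" if "is_perm \<gamma>" "balloon2413 \<gamma> \<preceq> \<beta>" for \<gamma>
    using pattern_le_trans[of \<gamma> "balloon2413 \<gamma>" \<beta>] pattern_le_balloon that assms(1) by simp
  then have "patterns \<beta> \<inter> balloon2413 ` Collect is_perm = balloon2413 ` ?In"
    unfolding patterns_def using is_perm_balloon by blast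
  then have "(\<Sum>\<sigma>\<in>patterns \<beta>. balloon_value \<sigma>) =
      pattern_sum (patterns \<beta>) + pattern_sum (balloon2413 ` ?In)"
    using fin units
    by (simp add: balloon_value_def sum.distrib sum_subtractf sum.inter_restrict[symmetric])
  also have "pattern_sum (balloon2413 ` ?In) = (\<Sum>\<gamma>\<in>?In. mobius [Suc 0] (balloon2413 \<gamma>))"
    by (subst sum.reindex) (auto simp: inj_on_def)
  also have "pattern_sum (patterns \<beta>) = (\<Sum>\<gamma>\<in>?N. mobius [Suc 0] (balloon2413 \<gamma>))"
    using pattern_sum_patterns pattern_sum_balloons assms by simp
  also have "(\<Sum>\<gamma>\<in>?N. mobius [Suc 0] (balloon2413 \<gamma>)) + (\<Sum>\<gamma>\<in>?In. mobius [Suc 0] (balloon2413 \<gamma>)) =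
      (\<Sum>\<gamma>\<in>?N \<union> ?In. mobius [Suc 0] (balloon2413 \<gamma>))"
    using fin by (intro sum.union_disjoint[symmetric]) auto
  also have "?N \<union> ?In = patterns \<beta>" by blast
  finally show ?thesis .
qed

text \<open>Moebius inversion: equal sums over all sets of patterns force equal values, by induction on the
  length.\<close>

lemma mobius_balloon:
  assumes "is_perm \<beta>"
  shows "mobius [Suc 0] (balloon2413 \<beta>) = balloon_value \<beta>"
  using assms
proof (induction "length \<beta>" arbitrary: \<beta> rule: less_induct)
  case less
  show ?case
  proof (cases "\<beta> = []")
    case True
    then show ?thesis by (auto simp: mobius_2413 balloon_value_def dest: arg_cong[where f = length])
  next
    case False
    have fin: "finite (patterns \<beta>)" using less.prems by (intro finite_patterns is_perm_distinct)
    have self: "\<beta> \<in> patterns \<beta>" using less.prems by (simp add: patterns_def)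
    have "mobius [Suc 0] (balloon2413 \<sigma>) = balloon_value \<sigma>" if "\<sigma> \<in> patterns \<beta> - {\<beta>}" for \<sigma>
      using less pattern_less_length[of \<sigma> \<beta>] that by (auto simp: patterns_def pattern_less_def)
    then show ?thesis
      using sum_balloon_value[OF less.prems False]
      by (simp add: sum.remove[OF fin self])
  qed
qed

theorem theorem65:
  fixes \<beta> \<pi> :: "nat list"
  assumes "is_perm \<beta>" and "\<beta> \<noteq> []" and "\<pi> = balloon2413 \<beta>"
  shows "mobius [1] \<pi> =
    (if \<beta> = [1] then 4
     else if \<beta> = [2, 4, 1, 3] then - 6
     else if is_balloon2413 \<beta> then 2 * mobius [1] \<beta>
     else mobius [1] \<beta>)"
proof -
  have "balloon2413 [] = [2, 4, 1, 3]" by (simp add: balloon2413_def)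
  then have balloon: "\<beta> \<in> balloon2413 ` Collect is_perm \<longleftrightarrow> \<beta> = [2, 4, 1, 3] \<or> is_balloon2413 \<beta>"
    unfolding is_balloon2413_def image_iff using is_perm_Nil by (metis mem_Collect_eq)
  have m2413: "mobius [1] [2, 4, 1, 3] = - 3"
    using mobius_2413 \<open>balloon2413 [] = [2, 4, 1, 3]\<close> by simp
  have "mobius [1] [1] = 1" by (subst mobius.simps) simp
  moreover have "\<not> is_balloon2413 [1]"
    by (auto simp: is_balloon2413_def dest: arg_cong[where f = length])
  moreover have "mobius [1] \<pi> = balloon_value \<beta>"
    using mobius_balloon[OF assms(1)] assms(3) by simp
  ultimately show ?thesis
    using m2413 assms(2) unfolding balloon_value_def balloon by auto
qed

end
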